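(* Let $q$ be an even power of an odd prime with $\sqrt{q} \equiv 1 \pmod 4$. In $\mathrm{PG}(2,q)$ let $\mathcal{C}$ be the conic $X_2^2 - X_1X_3 = 0$ and let $\perp$ be the orthogonal polarity defined by $\mathcal{C}$, mapping $P=(x_1,x_2,x_3)$ to the line $P^\perp: x_3X_1 - 2x_2X_2 + x_1X_3 = 0$. Let $K$ be the group of collineations induced by the matrices $$\begin{pmatrix} a^2 & 2ac & c^2 \\ 0 & a & c \\ 0 & 0 & 1 \end{pmatrix},\qquad a,c \in \mathbb{F}_q,\ a^{\sqrt{q}+1}=1.$$ Let $\mathcal{O}$ be any $K$-orbit consisting of internal points of $\mathcal{C}$. Then for every point $P \in \mathcal{O}$, no point of $\mathcal{O}$ lies on the line $P^\perp$.
   Context: A point $(x_1,x_2,x_3)\notin\mathcal{C}$ is internal to $\mathcal{C}$ (lies on no tangent line of $\mathcal{C}$) iff $x_2^2-x_1x_3$ is a non-square in $\mathbb{F}_q$. Points are column vectors and matrices act on the left. *)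

theory Defs
  imports "HOL-Analysis.Analysis" "HOL-Algebra.Group_Action" "HOL-Computational_Algebra.Primes"
    "HOL-Number_Theory.Cong"
begin

text \<open>
  \<open>PG(2,q)\<close> is modelled by the subspaces of the three-dimensional column space over a finite
  field with \<open>q\<close> elements; a point \<open>P\<close> lies on a line \<open>L\<close> iff \<open>P \<subseteq> L\<close>. In the index type
  \<open>3\<close> the three coordinates are \<open>1\<close>, \<open>2\<close> and \<open>3\<close>.
\<close>

definition pg_points :: "('a::field ^ 3) set set" where
  "pg_points = {P. vec.subspace P \<and> vec.dim P = 1}"

definition pg_lines :: "('a::field ^ 3) set set" where
  "pg_lines = {L. vec.subspace L \<and> vec.dim L = 2}"

definition conic :: "('a::field ^ 3) set set" where
  "conic = {P \<in> pg_points. \<forall>x\<in>P. (x $ 2)\<^sup>2 - x $ 1 * x $ 3 = 0}"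

definition conic_tangent :: "('a::field ^ 3) set \<Rightarrow> bool" where
  "conic_tangent L \<longleftrightarrow> L \<in> pg_lines \<and> (\<exists>!P. P \<in> conic \<and> P \<subseteq> L)"

definition conic_internal :: "('a::field ^ 3) set \<Rightarrow> bool" where
  "conic_internal P \<longleftrightarrow>
     P \<in> pg_points \<and> P \<notin> conic \<and> \<not> (\<exists>L. conic_tangent L \<and> P \<subseteq> L)"

text \<open>
  The equation of the polar line of a point is homogeneous in the coordinates of the point, so
  quantifying over all vectors of \<open>P\<close> is the same as choosing one nonzero representative.
\<close>

definition polar :: "('a::field ^ 3) set \<Rightarrow> ('a ^ 3) set" where
  "polar P = {X. \<forall>x\<in>P. x $ 3 * X $ 1 - 2 * x $ 2 * X $ 2 + x $ 1 * X $ 3 = 0}"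

definition K_matrix :: "'a::field \<Rightarrow> 'a \<Rightarrow> 'a ^ 3 ^ 3" where
  "K_matrix a c = vector [vector [a\<^sup>2, 2 * a * c, c\<^sup>2],
                          vector [0, a, c],
                          vector [0, 0, 1]]"

definition collineation :: "'a::field ^ 3 ^ 3 \<Rightarrow> ('a ^ 3) set \<Rightarrow> ('a ^ 3) set" where
  "collineation A = (\<lambda>P\<in>pg_points. (*v) A ` P)"

text \<open>The parameter \<open>s\<close> plays the role of the square root of \<open>q\<close>.\<close>

definition K_group :: "nat \<Rightarrow> (('a::field ^ 3) set \<Rightarrow> ('a ^ 3) set) monoid" where
  "K_group s = BijGroup pg_points
     \<lparr>carrier := {collineation (K_matrix a c) | a c. a ^ (s + 1) = 1}\<rparr>"

lemma pg_points_iff: "P \<in> pg_points \<longleftrightarrow> (\<exists>x. x \<noteq> 0 \<and> P = vec.span {x})"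
proof
  assume "P \<in> pg_points"
  hence s: "vec.subspace P" and d: "vec.dim P = 1" by (auto simp: pg_points_def)
  obtain B where B: "B \<subseteq> P" "vec.independent B" "P \<subseteq> vec.span B" "card B = vec.dim P"
    using vec.basis_exists by blast
  then obtain x where x: "B = {x}" using d by (metis card_1_singletonE)
  have "x \<noteq> 0" using B(2) x vec.dependent_zero by blast
  moreover have "P = vec.span {x}" using B x s by (simp add: vec.span_minimal subset_antisym)
  ultimately show "\<exists>x. x \<noteq> 0 \<and> P = vec.span {x}" by blast
next
  assume "\<exists>x. x \<noteq> 0 \<and> P = vec.span {x}"
  then obtain x where x: "x \<noteq> 0" "P = vec.span {x}" by blast
  have "vec.independent {x}" using x by simp
  hence "vec.dim (vec.span {x}) = 1"
    by (metis is_singletonI is_singleton_altdef vec.dim_span_eq_card_independent)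
  thus "P \<in> pg_points" using x by (simp add: pg_points_def)
qed

lemma K_matrix_vec:
  "(K_matrix a c *v x) $ 1 = a\<^sup>2 * x $ 1 + 2 * a * c * x $ 2 + c\<^sup>2 * x $ 3"
  "(K_matrix a c *v x) $ 2 = a * x $ 2 + c * x $ 3"
  "(K_matrix a c *v x) $ 3 = x $ 3"
  by (simp_all add: K_matrix_def matrix_vector_mult_def sum_3)

lemma K_matrix_mult:
  "K_matrix a c *v (K_matrix a' c' *v x) = K_matrix (a * a') (a * c' + c) *v x"
  by (simp add: vec_eq_iff forall_3 K_matrix_vec power2_eq_square algebra_simps)

lemma K_matrix_one: "K_matrix 1 0 *v x = x"
  by (simp add: vec_eq_iff forall_3 K_matrix_vec)

lemma K_matrix_image_point:
  assumes "a \<noteq> 0" "P \<in> pg_points"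
  shows "(*v) (K_matrix a c) ` P \<in> pg_points"
proof -
  obtain x where x: "x \<noteq> 0" "P = vec.span {x}" using assms pg_points_iff by blast
  have "K_matrix (1/a) (-c/a) *v (K_matrix a c *v x) = x"
    using assms by (simp add: K_matrix_mult K_matrix_one)
  hence "K_matrix a c *v x \<noteq> 0" using x by (metis matrix_vector_mult_0_right)
  moreover have "(*v) (K_matrix a c) ` P = vec.span {K_matrix a c *v x}"
    using vec.linear_span_image[OF matrix_vector_mul_linear_gen, of "K_matrix a c" "{x}"] x
    by simp
  ultimately show ?thesis using pg_points_iff by blast
qed

lemma collineation_compose:
  assumes "a \<noteq> 0" "a' \<noteq> 0"
  shows "compose pg_points (collineation (K_matrix a c)) (collineation (K_matrix a' c'))
         = collineation (K_matrix (a * a') (a * c' + c))"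
  using assms
  by (auto simp: compose_def collineation_def K_matrix_image_point image_image K_matrix_mult
      intro!: restrict_ext)

lemma collineation_one: "collineation (K_matrix 1 0) = (\<lambda>P\<in>pg_points. P)"
  by (auto simp: collineation_def K_matrix_one intro!: restrict_ext)

lemma collineation_Bij:
  assumes "a \<noteq> 0"
  shows "collineation (K_matrix a c) \<in> Bij pg_points"
proof -
  have "bij_betw (collineation (K_matrix a c)) pg_points pg_points"
    by (rule bij_betwI[where g = "collineation (K_matrix (1/a) (-c/a))"])
      (use assms in \<open>auto simp: collineation_def K_matrix_image_point image_image K_matrix_mult K_matrix_one\<close>)
  thus ?thesis by (simp add: Bij_def collineation_def)
qed

lemma K_group_subgroup:
  "subgroup (carrier (K_group s)) (BijGroup (pg_points :: ('a::field ^ 3) set set))"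
proof -
  interpret B: group "BijGroup (pg_points :: ('a ^ 3) set set)" by (rule group_BijGroup)
  have nz: "a \<noteq> 0" if "a ^ (s + 1) = 1" for a :: 'a using that by auto
  let ?f = "\<lambda>a c :: 'a. collineation (K_matrix a c)"
  have C: "carrier (K_group s) = {?f a c | a c. a ^ (s + 1) = 1}" by (simp add: K_group_def)
  have m: "?f a c \<otimes>\<^bsub>BijGroup pg_points\<^esub> ?f a' c' = ?f (a * a') (a * c' + c)"
    if "a \<noteq> 0" "a' \<noteq> 0" for a a' c c'
    using that by (simp add: BijGroup_def collineation_Bij collineation_compose)
  have one: "\<one>\<^bsub>BijGroup pg_points\<^esub> = ?f 1 0" by (simp add: BijGroup_def collineation_one)
  have car: "?f a c \<in> carrier (BijGroup pg_points)" if "a \<noteq> 0" for a c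
    using that by (simp add: BijGroup_def collineation_Bij)
  have inv: "inv\<^bsub>BijGroup pg_points\<^esub> (?f a c) = ?f (1/a) (-c/a)" if "a \<noteq> 0" for a c
    by (rule B.inv_equality) (use that in \<open>simp_all add: m one car\<close>)
  show ?thesis
  proof (rule B.subgroupI)
    show "carrier (K_group s) \<subseteq> carrier (BijGroup (pg_points :: ('a ^ 3) set set))"
      unfolding C using car nz by blast
    show "carrier (K_group s) \<noteq> ({} :: (('a ^ 3) set \<Rightarrow> ('a ^ 3) set) set)"
      unfolding C using power_one by blast
  next
    fix g :: "('a ^ 3) set \<Rightarrow> ('a ^ 3) set"
    assume "g \<in> carrier (K_group s)"
    then obtain a c where g: "g = ?f a c" "a ^ (s + 1) = 1" unfolding C by blast
    have "(1/a) ^ (s + 1) = 1" using g(2) by (simp only: power_one_over) simp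
    thus "inv\<^bsub>BijGroup pg_points\<^esub> g \<in> carrier (K_group s)"
      unfolding C g(1) inv[OF nz[OF g(2)]] by blast
  next
    fix g h :: "('a ^ 3) set \<Rightarrow> ('a ^ 3) set"
    assume "g \<in> carrier (K_group s)" "h \<in> carrier (K_group s)"
    then obtain a c a' c' where g: "g = ?f a c" "a ^ (s + 1) = 1"
      and h: "h = ?f a' c'" "a' ^ (s + 1) = 1" unfolding C by blast
    have "(a * a') ^ (s + 1) = 1" using g(2) h(2) by (simp only: power_mult_distrib) simp
    thus "g \<otimes>\<^bsub>BijGroup pg_points\<^esub> h \<in> carrier (K_group s)"
      unfolding C g(1) h(1) m[OF nz[OF g(2)] nz[OF h(2)]] by blast
  qed
qed

end

theory Submission
  imports Defs "HOL-Computational_Algebra.Polynomial" "HOL-Number_Theory.Residues"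
begin

text \<open>
  Normalise a point \<open>P\<close> of the orbit to \<open>(x\<^sub>1, x\<^sub>2, 1)\<close> and put \<open>D = x\<^sub>2\<^sup>2 - x\<^sub>1\<close>, a non-square because
  \<open>P\<close> is internal. Completing the square, the image of \<open>P\<close> under the matrix with parameters \<open>a, c\<close>
  lies on the polar line of \<open>P\<close> iff \<open>(c + (a - 1) x\<^sub>2)\<^sup>2 = (a\<^sup>2 + 1) D\<close>. Since \<open>s \<equiv> 1 (mod 4)\<close>,
  \<open>a\<^sup>2 = -1\<close> would give \<open>a\<^sup>s\<^sup>+\<^sup>1 = -1\<close>, so \<open>u = a\<^sup>2 + 1\<close> is nonzero. The Frobenius map \<open>x \<mapsto> x\<^sup>s\<close> sends
  \<open>a\<close> to \<open>1/a\<close>, hence \<open>u\<^sup>s\<^sup>-\<^sup>1 = a\<^sup>-\<^sup>2\<close>, and raising this to the power \<open>(s + 1)/2\<close> shows that \<open>u\<close> is a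
  square by Euler's criterion. Then \<open>D\<close> would be a square, a contradiction.
\<close>

section \<open>Squares in finite fields of odd order\<close>

lemma finite_field_power_card_minus_1:
  fixes x :: "'a::{field,finite}"
  assumes "x \<noteq> 0"
  shows "x ^ (CARD('a) - 1) = 1"
proof -
  let ?U = "UNIV - {0::'a}"
  have "bij_betw ((*) x) ?U ?U"
    by (rule bij_betwI[where g = "\<lambda>y. y / x"]) (use assms in auto)
  hence "(\<Prod>y\<in>?U. y) = (\<Prod>y\<in>?U. x * y)"
    by (rule prod.reindex_bij_betw[symmetric])
  also have "\<dots> = x ^ (CARD('a) - 1) * \<Prod>?U"
    by (simp add: prod.distrib card_Diff_singleton)
  finally show ?thesis by simp
qed

text \<open>Squaring is at most two-to-one, so the \<open>2 * n\<close> nonzero elements have at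
  least \<open>n\<close> distinct squares. All of these are roots of \<open>X^n - 1\<close>, which
  has at most \<open>n\<close> roots; hence every root is a square.\<close>

lemma finite_field_Euler_criterion:
  fixes x :: "'a::{field,finite}"
  assumes odd: "odd (CARD('a))" and x: "x ^ ((CARD('a) - 1) div 2) = 1"
  shows "\<exists>y. x = y\<^sup>2"
proof -
  define n where "n = (CARD('a) - 1) div 2"
  define S where "S = power2 ` (UNIV - {0::'a})"
  define R where "R = {x::'a. x ^ n = 1}"
  have n: "2 * n = CARD('a) - 1" using odd by (simp add: n_def)
  \<comment> \<open>Together with oddness this gives at least three elements, so \<open>n\<close> is
    positive and the coefficient of \<open>f\<close> at \<open>n\<close> is not disturbed by its
    constant term.\<close>
  have "card {0::'a, 1} \<le> CARD('a)" by (intro card_mono) auto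
  hence n0: "n > 0" using odd n by (cases "CARD('a) = 2") auto
  have fibre: "card {z. z\<^sup>2 = y} \<le> 2" for y :: 'a
  proof (cases "\<exists>z. z\<^sup>2 = y")
    case True
    then obtain z where "z\<^sup>2 = y" by blast
    hence "{z. z\<^sup>2 = y} \<subseteq> {z, -z}" by (auto simp: power2_eq_iff)
    hence "card {z. z\<^sup>2 = y} \<le> card {z, -z}" by (intro card_mono) auto
    also have "\<dots> \<le> 2" by (rule card_insert_le_m1) simp_all
    finally show ?thesis .
  qed simp
  have "2 * n = card (UNIV - {0::'a})" by (simp add: n card_Diff_singleton)
  also have "\<dots> \<le> card (\<Union>y\<in>S. {z. z\<^sup>2 = y})" by (intro card_mono) (auto simp: S_def)
  also have "\<dots> \<le> (\<Sum>y\<in>S. card {z. z\<^sup>2 = y})" by (rule card_UN_le) simp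
  also have "\<dots> \<le> card S * 2"
    using sum_bounded_above[of S "\<lambda>y. card {z. z\<^sup>2 = y}" 2] fibre by simp
  finally have S: "n \<le> card S" by simp
  have SR: "S \<subseteq> R"
    using finite_field_power_card_minus_1
    by (auto simp: S_def R_def n simp flip: power_mult)
  define f where "f = Polynomial.monom (1::'a) n - 1"
  have "Polynomial.coeff f n = 1" using n0 by (simp add: f_def)
  hence "f \<noteq> 0" by auto
  moreover have "degree f \<le> n" unfolding f_def
    by (intro degree_diff_le degree_monom_le) simp
  moreover have "R = {x. poly f x = 0}" by (simp add: R_def f_def poly_monom)
  ultimately have "card R \<le> n" using card_poly_roots_bound[of f] by simp
  hence "S = R" using S SR by (intro card_seteq) auto
  moreover have "x \<in> R" using x by (simp add: R_def n_def)
  ultimately show ?thesis by (auto simp: S_def)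
qed

section \<open>Characteristic and elements of norm one\<close>

lemma CHAR_eq_of_CARD_prime_power:
  assumes "prime p" and "CARD('a::{field,finite}) = p ^ m"
  shows "CHAR('a) = p"
proof -
  have "prime CHAR('a)" by (intro prime_CHAR_semidom finite_imp_CHAR_pos) simp
  moreover have "CHAR('a) dvd p ^ m" using CHAR_dvd_CARD[where 'a = 'a] assms(2) by simp
  ultimately show ?thesis using assms(1) prime_dvd_power primes_dvd_imp_eq by blast
qed

lemma norm_one_sq_plus_one:
  fixes a :: "'a::{field,finite}"
  assumes p: "prime p" "odd p" and s: "s = p ^ k" and card: "CARD('a) = s\<^sup>2"
    and s4: "[s = 1] (mod 4)" and a: "a ^ (s + 1) = 1"
  shows "a\<^sup>2 + 1 \<noteq> 0" and "\<exists>y. a\<^sup>2 + 1 = y\<^sup>2"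
proof -
  have char: "CHAR('a) = p"
    by (rule CHAR_eq_of_CARD_prime_power[of _ "k * 2"]) (use p card s in \<open>auto simp: power_mult\<close>)
  have odd: "odd s" using p s by simp
  have s4': "s mod 4 = 1" using s4 by (simp add: cong_def)
  define l where "l = s div 4"
  have l: "s = 4 * l + 1" using s4' div_mult_mod_eq[of s 4] by (simp add: l_def)
  \<comment> \<open>Here the congruence of \<open>s\<close> modulo 4 enters: half of
    \<open>s + 1\<close> is odd, so -1 does not satisfy the equation \<open>a2l\<close> for the
    square of \<open>a\<close>.\<close>
  have "s + 1 = 2 * (2 * l + 1)" using l by simp
  hence a2l: "(a\<^sup>2) ^ (2 * l + 1) = 1" using a by (metis power_mult)
  have "\<not> p dvd 2" using p primes_dvd_imp_eq[OF _ two_is_prime_nat] by blast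
  hence two: "(2::'a) \<noteq> 0"
    using of_nat_eq_0_iff_char_dvd[of 2, where 'a = 'a] char by simp
  show nz: "a\<^sup>2 + 1 \<noteq> 0"
  proof
    assume "a\<^sup>2 + 1 = 0"
    hence "a\<^sup>2 = -1" by (simp add: eq_neg_iff_add_eq_0)
    hence "(1::'a) = -1" using a2l by simp
    hence "(2::'a) = 0" by (metis add.right_inverse one_add_one)
    thus False using two by simp
  qed
  define u where "u = a\<^sup>2 + 1"
  \<comment> \<open>Raising to the power \<open>s\<close> is additive because \<open>s\<close> is a
    power of the characteristic.\<close>
  have "u ^ s = (a\<^sup>2) ^ s + 1"
    unfolding u_def using freshmans_dream'[of s k "a\<^sup>2" 1] char p s by simp
  hence "u ^ s * a\<^sup>2 = (a ^ (s + 1))\<^sup>2 + a\<^sup>2"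
    by (simp add: algebra_simps power2_eq_square power_mult_distrib)
  hence us: "u ^ s * a\<^sup>2 = u" using a by (simp add: u_def)
  have "u ^ s = u ^ (4 * l) * u" by (simp add: l)
  hence "u ^ (4 * l) * a\<^sup>2 = 1" using us nz by (simp add: u_def[symmetric] mult.assoc mult.left_commute)
  \<comment> \<open>By \<open>a2l\<close> this exponent removes the factor in \<open>a\<close>. What
    remains is \<open>u\<close> to the power \<open>(s - 1) * (s + 1) / 2\<close>, half the order of
    the multiplicative group.\<close>
  hence "(u ^ (4 * l) * a\<^sup>2) ^ (2 * l + 1) = 1" by simp
  hence "u ^ (4 * l * (2 * l + 1)) = 1"
    by (simp only: power_mult_distrib a2l power_mult mult_1_right)
  moreover have "(CARD('a) - 1) div 2 = 4 * l * (2 * l + 1)"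
    by (simp add: card l power2_eq_square algebra_simps)
  ultimately show "\<exists>y. a\<^sup>2 + 1 = y\<^sup>2"
    using odd finite_field_Euler_criterion[of u] by (simp add: card u_def)
qed

section \<open>Tangent lines and internal points\<close>

text \<open>Reduces tangency, a statement about subspaces, to coordinates: if all zeros of the
  quadratic form on the line are multiples of \<open>z\<close>, then \<open>z\<close> spans its only
  conic point.\<close>

lemma conic_tangent_span:
  fixes v w z :: "'a::field ^ 3"
  assumes ind: "vec.independent {v, w}" "v \<noteq> w" and z: "z \<noteq> 0"
    and L: "L = vec.span {v, w}" and zL: "z \<in> L" and zc: "(z $ 2)\<^sup>2 - z $ 1 * z $ 3 = 0"
    and uniq: "\<And>x. x \<in> L \<Longrightarrow> (x $ 2)\<^sup>2 - x $ 1 * x $ 3 = 0 \<Longrightarrow> x \<in> vec.span {z}"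
  shows "conic_tangent L"
  unfolding conic_tangent_def
proof (intro conjI ex1I[of _ "vec.span {z}"])
  show "L \<in> pg_lines"
    using ind vec.dim_span_eq_card_independent[OF ind(1)] by (simp add: pg_lines_def L)
  show "vec.span {z} \<in> conic"
  proof -
    have "(x $ 2)\<^sup>2 - x $ 1 * x $ 3 = 0" if "x \<in> vec.span {z}" for x
    proof -
      from that obtain k where "x = k *s z" by (auto simp: vec.span_singleton)
      hence "(x $ 2)\<^sup>2 - x $ 1 * x $ 3 = k\<^sup>2 * ((z $ 2)\<^sup>2 - z $ 1 * z $ 3)"
        by (simp add: power2_eq_square algebra_simps)
      thus ?thesis using zc by simp
    qed
    thus ?thesis using z pg_points_iff by (auto simp: conic_def)
  qed
  show "vec.span {z} \<subseteq> L" using zL unfolding L by (intro vec.span_minimal) auto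
  show "P = vec.span {z}" if P: "P \<in> conic \<and> P \<subseteq> L" for P
  proof -
    obtain x where x: "x \<noteq> 0" "P = vec.span {x}" using P by (auto simp: conic_def pg_points_iff)
    hence "x \<in> P" by (simp add: vec.span_base)
    hence "x \<in> vec.span {z}" using P uniq by (auto simp: conic_def)
    then obtain k where k: "x = k *s z" by (auto simp: vec.span_singleton)
    hence "k \<noteq> 0" using x by auto
    hence "z = (1/k) *s x" using k by simp
    hence "z \<in> P" using x(2) by (metis vec.span_base vec.span_scale singletonI)
    thus ?thesis using k x(2) \<open>x \<in> vec.span {z}\<close> by (simp add: vec.span_minimal subset_antisym)
  qed
qed

lemma conic_tangent_at_infinity: "conic_tangent {X::'a::field ^ 3. X $ 3 = 0}"
proof (rule conic_tangent_span)
  let ?v = "vector [1, 0, 0] :: 'a ^ 3" and ?w = "vector [0, 1, 0] :: 'a ^ 3"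
  show "?v \<noteq> ?w" by (simp add: vec_eq_iff forall_3)
  show "vec.independent {?v, ?w}"
    by (auto simp: vec.independent_insert vec.span_singleton vec_eq_iff forall_3)
  show "{X::'a ^ 3. X $ 3 = 0} = vec.span {?v, ?w}"
    by (auto simp: vec.span_insert vec.span_singleton vec_eq_iff forall_3)
  show "?v \<noteq> 0" by (simp add: vec_eq_iff forall_3)
  show "?v \<in> {X. X $ 3 = 0}" "(?v $ 2)\<^sup>2 - ?v $ 1 * ?v $ 3 = 0" by simp_all
  show "x \<in> vec.span {?v}"
    if "x \<in> {X. X $ 3 = 0}" "(x $ 2)\<^sup>2 - x $ 1 * x $ 3 = 0" for x
    using that by (auto simp: vec.span_singleton vec_eq_iff forall_3)
qed

text \<open>This is the tangent at \<open>(y^2, y, 1)\<close>: restricted to the line, the quadratic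
  form becomes the square of \<open>x $ 2 - y * x $ 3\<close>.\<close>

lemma conic_tangent_affine:
  "conic_tangent {X::'a::field ^ 3. X $ 1 - 2 * y * X $ 2 + y\<^sup>2 * X $ 3 = 0}" (is "conic_tangent ?L")
proof (rule conic_tangent_span)
  let ?v = "vector [2 * y, 1, 0] :: 'a ^ 3" and ?w = "vector [- (y\<^sup>2), 0, 1] :: 'a ^ 3"
    and ?z = "vector [y\<^sup>2, y, 1] :: 'a ^ 3"
  show "?v \<noteq> ?w" by (simp add: vec_eq_iff forall_3)
  show "vec.independent {?v, ?w}"
    by (auto simp: vec.independent_insert vec.span_singleton vec_eq_iff forall_3)
  show "?L = vec.span {?v, ?w}"
    by (auto simp: vec.span_insert vec.span_singleton vec_eq_iff forall_3 algebra_simps)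
  show "?z \<noteq> 0" by (simp add: vec_eq_iff forall_3)
  show "?z \<in> ?L" "(?z $ 2)\<^sup>2 - ?z $ 1 * ?z $ 3 = 0"
    by (simp_all add: power2_eq_square)
  show "x \<in> vec.span {?z}" if "x \<in> ?L" "(x $ 2)\<^sup>2 - x $ 1 * x $ 3 = 0" for x
  proof -
    have x1: "x $ 1 = 2 * y * x $ 2 - y\<^sup>2 * x $ 3" using that(1) by (simp add: algebra_simps)
    have "(x $ 2 - y * x $ 3)\<^sup>2 = 0"
      using that(2) unfolding x1 by (simp add: power2_eq_square algebra_simps)
    hence "x $ 2 = y * x $ 3" by simp
    hence "x = x $ 3 *s ?z" using x1 by (simp add: vec_eq_iff forall_3 power2_eq_square)
    thus ?thesis by (auto simp: vec.span_singleton)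
  qed
qed

lemma conic_internal_span:
  fixes x :: "'a::field ^ 3"
  assumes "conic_internal (vec.span {x})"
  shows "x $ 3 \<noteq> 0" and "(x $ 2)\<^sup>2 - x $ 1 * x $ 3 \<noteq> t\<^sup>2"
proof -
  have no: "\<not> vec.span {x} \<subseteq> L" if "conic_tangent L" for L
    using assms that by (auto simp: conic_internal_def)
  show x3: "x $ 3 \<noteq> 0"
    using no[OF conic_tangent_at_infinity] by (auto simp: vec.span_singleton)
  show "(x $ 2)\<^sup>2 - x $ 1 * x $ 3 \<noteq> t\<^sup>2"
  proof
    assume t: "(x $ 2)\<^sup>2 - x $ 1 * x $ 3 = t\<^sup>2"
    \<comment> \<open>The affine tangent with parameter \<open>y\<close> contains \<open>x\<close>
      iff \<open>y\<close> is a root of a quadratic whose discriminant is four times the form at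
      \<open>x\<close>; a square root \<open>t\<close> of the form yields this root.\<close>
    define y where "y = (x $ 2 + t) / x $ 3"
    have y: "y * x $ 3 = x $ 2 + t" using x3 by (simp add: y_def)
    have "x $ 3 * (x $ 1 - 2 * y * x $ 2 + y\<^sup>2 * x $ 3)
        = x $ 1 * x $ 3 - 2 * (y * x $ 3) * x $ 2 + (y * x $ 3)\<^sup>2"
      by (simp add: power2_eq_square algebra_simps)
    also have "\<dots> = t\<^sup>2 - ((x $ 2)\<^sup>2 - x $ 1 * x $ 3)"
      unfolding y by (simp add: power2_eq_square algebra_simps)
    finally have eq: "x $ 1 - 2 * y * x $ 2 + y\<^sup>2 * x $ 3 = 0" using t x3 by simp
    have "k * x $ 1 - 2 * y * (k * x $ 2) + y\<^sup>2 * (k * x $ 3) = 0" for k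
      using arg_cong[OF eq, of "(*) k"] by (simp add: algebra_simps)
    hence "vec.span {x} \<subseteq> {X. X $ 1 - 2 * y * X $ 2 + y\<^sup>2 * X $ 3 = 0}"
      by (auto simp: vec.span_singleton)
    thus False using no[OF conic_tangent_affine] by blast
  qed
qed

section \<open>Orbits and polar lines\<close>

text \<open>Completing the square in homogeneous form, without scaling the third coordinate to
  1.\<close>

lemma K_matrix_polar_form:
  fixes x :: "'a::field ^ 3" and a c :: 'a
  defines "X \<equiv> K_matrix a c *v x"
  shows "x $ 3 * X $ 1 - 2 * x $ 2 * X $ 2 + x $ 1 * X $ 3
     = (c * x $ 3 + (a - 1) * x $ 2)\<^sup>2 - (a\<^sup>2 + 1) * ((x $ 2)\<^sup>2 - x $ 1 * x $ 3)"
  unfolding X_def K_matrix_vec by (simp add: power2_eq_square algebra_simps)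

lemma K_image_not_polar:
  fixes x :: "'a::field ^ 3"
  assumes int: "conic_internal (vec.span {x})" and nz: "a\<^sup>2 + 1 \<noteq> 0" and sq: "a\<^sup>2 + 1 = y\<^sup>2"
  shows "K_matrix a c *v x \<notin> polar (vec.span {x})"
proof
  assume "K_matrix a c *v x \<in> polar (vec.span {x})"
  hence "(c * x $ 3 + (a - 1) * x $ 2)\<^sup>2 = y\<^sup>2 * ((x $ 2)\<^sup>2 - x $ 1 * x $ 3)"
    using K_matrix_polar_form[of x a c] vec.span_base[of x "{x}"] by (simp add: polar_def sq)
  \<comment> \<open>\<open>y\<close> is nonzero since its square is, so dividing exhibits the form
    at \<open>x\<close> as a square.\<close>
  hence "(x $ 2)\<^sup>2 - x $ 1 * x $ 3 = ((c * x $ 3 + (a - 1) * x $ 2) / y)\<^sup>2"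
    using nz sq by (simp add: power_divide)
  thus False using conic_internal_span(2)[OF int] by blast
qed

lemma K_orbit_related:
  assumes "Orb \<in> orbits (K_group s) pg_points (\<lambda>g. g)" "P \<in> Orb" "R \<in> Orb"
  obtains a c where "a ^ (s + 1) = 1" "R = (*v) (K_matrix a c) ` P"
proof -
  obtain Q where Q: "Q \<in> pg_points" and Orb: "Orb = orbit (K_group s) (\<lambda>g. g) Q"
    using assms(1) by (auto simp: orbits_def)
  have "\<exists>a c. a ^ (s + 1) = 1 \<and> T = (*v) (K_matrix a c) ` Q" if "T \<in> Orb" for T
    using that Q unfolding Orb orbit_def K_group_def by (fastforce simp: collineation_def)
  then obtain a c b d where P: "a ^ (s + 1) = 1" "P = (*v) (K_matrix a c) ` Q"
    and R: "b ^ (s + 1) = 1" "R = (*v) (K_matrix b d) ` Q"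
    using assms(2,3) by metis
  have a0: "a \<noteq> 0" using P(1) by auto
  show ?thesis
  proof
    show "(b / a) ^ (s + 1) = 1" using P(1) R(1) by (simp only: power_divide) simp
    \<comment> \<open>The parameters solve the composition law: this matrix is that of
      \<open>(b, d)\<close> times the inverse of that of \<open>(a, c)\<close>, leading from
      \<open>P\<close> back to \<open>Q\<close> and on to \<open>R\<close>.\<close>
    show "R = (*v) (K_matrix (b / a) (d - b / a * c)) ` P"
      using a0 by (simp add: P R image_image K_matrix_mult)
  qed
qed

theorem theorem2p10:
  fixes p m q s :: nat
    and Orb :: "('a::{field,finite} ^ 3) set set"
  assumes "prime p" and "odd p"
    and "m > 0" and "even m" and "q = p ^ m"
    and "s\<^sup>2 = q" and "[s = 1] (mod 4)"
    and "CARD('a) = q"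
    and "Orb \<in> orbits (K_group s) pg_points (\<lambda>g. g)"
    and "\<forall>P\<in>Orb. conic_internal P"
  shows "\<forall>P\<in>Orb. \<not> (\<exists>R\<in>Orb. R \<subseteq> polar P)"
proof (intro ballI notI, elim bexE)
  fix P R assume P: "P \<in> Orb" and R: "R \<in> Orb" and polar: "R \<subseteq> polar P"
  obtain a c where a: "a ^ (s + 1) = 1" and RP: "R = (*v) (K_matrix a c) ` P"
    using K_orbit_related[OF assms(9) P R] .
  have int: "conic_internal P" using assms(10) P by blast
  then obtain x where x: "P = vec.span {x}" by (auto simp: conic_internal_def pg_points_iff)
  \<comment> \<open>Evenness of \<open>m\<close> makes \<open>s\<close> itself a power of
    \<open>p\<close>, as the Frobenius argument requires.\<close>
  have "s\<^sup>2 = (p ^ (m div 2))\<^sup>2" using assms(4-6) by (simp flip: power_mult)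
  hence s: "s = p ^ (m div 2)" by (simp add: power2_eq_iff_nonneg)
  note sq = norm_one_sq_plus_one[OF assms(1,2) s _ assms(7) a]
  obtain y where "a\<^sup>2 + 1 = y\<^sup>2" using sq(2) assms(6,8) by auto
  moreover have "a\<^sup>2 + 1 \<noteq> 0" using sq(1) assms(6,8) by simp
  ultimately have "K_matrix a c *v x \<notin> polar P"
    using K_image_not_polar int unfolding x by blast
  moreover have "K_matrix a c *v x \<in> R" unfolding RP x by (intro imageI vec.span_base) simp
  ultimately show False using polar by blast
qed

end
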